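(* Let $\Gamma$ be a cofinite directed graph with completion $\overline\Gamma$. Then $\overline\Gamma$ is a profinite directed graph, and the cofinite entourages of $\overline\Gamma$ are precisely all the sets $\overline R$, where $R$ runs through all cofinite entourages of $\Gamma$ and $\overline R$ denotes the closure of $R$ in $\overline\Gamma\times\overline\Gamma$.
   Context: A directed graph is a set $\Gamma$ with a distinguished subset $V(\Gamma)$ and two functions $s,t\colon\Gamma\to V(\Gamma)$ satisfying $s(x)=t(x)=x$ for all $x\in V(\Gamma)$. A sub-directed graph is a subset closed under $s$ and $t$; a map of directed graphs is a function preserving sources and targets. A topological directed graph is a directed graph with a topology such that $s,t\colon\Gamma\to V(\Gamma)$ are continuous ($V(\Gamma)$ with the subspace topology). A profinite directed graph is a topological directed graph that is the limit of an inverse system of finite discrete topological directed graphs; equivalently, a compact Hausdorff totally disconnected topological directed graph. An equivalence relation $R$ on $\Gamma$ is compatible if $(x,y)\in R$ implies $(s(x),s(y))\in R$ and $(t(x),t(y))\in R$; it has finite index if $\Gamma/R$ is finite. For a directed graph with a uniformity, a cofinite entourage is a compatible equivalence relation of finite index which is also an entourage. A cofinite directed graph is a directed graph endowed with a Hausdorff uniformity that has a base consisting of cofinite entourages. Every compact Hausdorff space is regarded as a uniform space with the unique uniformity inducing its topology. A completion of a cofinite directed graph $\Gamma$ is a compact Hausdorff topological directed graph $\overline\Gamma$ that contains $\Gamma$ as a dense uniform sub-directed graph (dense, and with the uniformity of $\Gamma$ induced from $\overline\Gamma$); it exists and is unique up to isomorphism of topological directed graphs extending the identity on $\Gamma$.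 *)

theory Defs
  imports "HOL-Analysis.Analysis"
begin

section \<open>Directed graphs\<close>

text \<open>
  Vertices are elements of the graph themselves. The functions \<open>src\<close> and \<open>tgt\<close> are only
  meaningful on \<open>elems\<close>; their values elsewhere are irrelevant. The graph may be empty.
\<close>

record 'a digraph =
  elems :: "'a set"
  verts :: "'a set"
  src :: "'a \<Rightarrow> 'a"
  tgt :: "'a \<Rightarrow> 'a"

definition digraph :: "'a digraph \<Rightarrow> bool" where
  "digraph G \<longleftrightarrow>
     verts G \<subseteq> elems G \<and>
     (\<forall>x\<in>elems G. src G x \<in> verts G \<and> tgt G x \<in> verts G) \<and>
     (\<forall>x\<in>verts G. src G x = x \<and> tgt G x = x)"

definition sub_digraph :: "'a digraph \<Rightarrow> 'a digraph \<Rightarrow> bool" where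
  "sub_digraph G H \<longleftrightarrow>
     digraph G \<and> digraph H \<and>
     elems G \<subseteq> elems H \<and> verts G = elems G \<inter> verts H \<and>
     (\<forall>x\<in>elems G. src G x = src H x \<and> tgt G x = tgt H x)"

definition digraph_map :: "'a digraph \<Rightarrow> 'b digraph \<Rightarrow> ('a \<Rightarrow> 'b) \<Rightarrow> bool" where
  "digraph_map G H f \<longleftrightarrow>
     f \<in> elems G \<rightarrow> elems H \<and>
     (\<forall>x\<in>elems G. f (src G x) = src H (f x) \<and> f (tgt G x) = tgt H (f x))"

section \<open>Topological and profinite directed graphs\<close>

definition topological_digraph :: "'a digraph \<Rightarrow> 'a topology \<Rightarrow> bool" where
  "topological_digraph G T \<longleftrightarrow>
     digraph G \<and> topspace T = elems G \<and>
     continuous_map T (subtopology T (verts G)) (src G) \<and>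
     continuous_map T (subtopology T (verts G)) (tgt G)"

definition topological_digraph_iso ::
  "'a digraph \<Rightarrow> 'a topology \<Rightarrow> 'b digraph \<Rightarrow> 'b topology \<Rightarrow> ('a \<Rightarrow> 'b) \<Rightarrow> bool" where
  "topological_digraph_iso G T H S f \<longleftrightarrow> digraph_map G H f \<and> homeomorphic_map T S f"

text \<open>
  In an inverse system, \<open>(i, j) \<in> le\<close> means \<open>i \<le> j\<close>, and \<open>\<phi> i j\<close> is the transition map
  from the \<open>j\<close>-th to the \<open>i\<close>-th object.
\<close>

definition inverse_system ::
  "'i set \<Rightarrow> 'i rel \<Rightarrow> ('i \<Rightarrow> 'b digraph) \<Rightarrow> ('i \<Rightarrow> 'b topology) \<Rightarrow> ('i \<Rightarrow> 'i \<Rightarrow> 'b \<Rightarrow> 'b) \<Rightarrow> bool"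
  where
  "inverse_system I le D S \<phi> \<longleftrightarrow>
     I \<noteq> {} \<and> partial_order_on I le \<and>
     (\<forall>i\<in>I. \<forall>j\<in>I. \<exists>k\<in>I. (i, k) \<in> le \<and> (j, k) \<in> le) \<and>
     (\<forall>i\<in>I. topological_digraph (D i) (S i)) \<and>
     (\<forall>(i, j)\<in>le. digraph_map (D j) (D i) (\<phi> i j) \<and> continuous_map (S j) (S i) (\<phi> i j)) \<and>
     (\<forall>i\<in>I. \<forall>x\<in>elems (D i). \<phi> i i x = x) \<and>
     (\<forall>i j k. (i, j) \<in> le \<longrightarrow> (j, k) \<in> le \<longrightarrow>
        (\<forall>x\<in>elems (D k). \<phi> i j (\<phi> j k x) = \<phi> i k x))"

definition inverse_limit ::
  "'i set \<Rightarrow> 'i rel \<Rightarrow> ('i \<Rightarrow> 'b digraph) \<Rightarrow> ('i \<Rightarrow> 'i \<Rightarrow> 'b \<Rightarrow> 'b) \<Rightarrow> ('i \<Rightarrow> 'b) digraph" where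
  "inverse_limit I le D \<phi> =
     \<lparr>elems = {x \<in> \<Pi>\<^sub>E i\<in>I. elems (D i). \<forall>(i, j)\<in>le. \<phi> i j (x j) = x i},
      verts = {x \<in> \<Pi>\<^sub>E i\<in>I. verts (D i). \<forall>(i, j)\<in>le. \<phi> i j (x j) = x i},
      src = (\<lambda>x. \<lambda>i\<in>I. src (D i) (x i)),
      tgt = (\<lambda>x. \<lambda>i\<in>I. tgt (D i) (x i))\<rparr>"

definition inverse_limit_topology ::
  "'i set \<Rightarrow> 'i rel \<Rightarrow> ('i \<Rightarrow> 'b digraph) \<Rightarrow> ('i \<Rightarrow> 'b topology) \<Rightarrow> ('i \<Rightarrow> 'i \<Rightarrow> 'b \<Rightarrow> 'b)
     \<Rightarrow> ('i \<Rightarrow> 'b) topology" where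
  "inverse_limit_topology I le D S \<phi> =
     subtopology (product_topology S I) (elems (inverse_limit I le D \<phi>))"

text \<open>
  A definition cannot quantify over types, so the types of the inverse system are fixed, without
  loss of generality: every finite directed graph is isomorphic to one whose elements are natural
  numbers, and a limit of finite discrete directed graphs is also the limit of its finite discrete
  quotients, which are indexed by equivalence relations on it, that is, by elements of
  \<open>('a \<times> 'a) set\<close>.
\<close>

definition profinite_digraph :: "'a digraph \<Rightarrow> 'a topology \<Rightarrow> bool" where
  "profinite_digraph G T \<longleftrightarrow>
     topological_digraph G T \<and>
     (\<exists>(I :: ('a \<times> 'a) set set) le (D :: ('a \<times> 'a) set \<Rightarrow> nat digraph) S \<phi> f.
        inverse_system I le D S \<phi> \<and>
        (\<forall>i\<in>I. finite (elems (D i)) \<and> S i = discrete_topology (elems (D i))) \<and>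
        topological_digraph_iso G T
          (inverse_limit I le D \<phi>) (inverse_limit_topology I le D S \<phi>) f)"

section \<open>Uniformities on a set\<close>

text \<open>
  The axioms of the class \<^class>\<open>uniform_space\<close>, relative to a carrier set. As there, a uniformity is
  the filter of its entourages; concentrating it on \<open>X \<times> X\<close> makes the subsets of \<open>X \<times> X\<close> belonging
  to the filter the entourages in the usual sense.
\<close>

definition uniformity_on :: "'a set \<Rightarrow> ('a \<times> 'a) filter \<Rightarrow> bool" where
  "uniformity_on X U \<longleftrightarrow>
     U \<le> principal (X \<times> X) \<and>
     (\<forall>E. eventually E U \<longrightarrow> (\<forall>x\<in>X. E (x, x))) \<and>
     (\<forall>E. eventually E U \<longrightarrow> eventually (\<lambda>(x, y). E (y, x)) U) \<and>
     (\<forall>E. eventually E U \<longrightarrow>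
        (\<exists>D. eventually D U \<and> (\<forall>x y z. D (x, y) \<longrightarrow> D (y, z) \<longrightarrow> E (x, z))))"

definition entourage :: "'a set \<Rightarrow> ('a \<times> 'a) filter \<Rightarrow> ('a \<times> 'a) set \<Rightarrow> bool" where
  "entourage X U E \<longleftrightarrow> E \<subseteq> X \<times> X \<and> eventually (\<lambda>p. p \<in> E) U"

definition uniform_topology :: "'a set \<Rightarrow> ('a \<times> 'a) filter \<Rightarrow> 'a topology" where
  "uniform_topology X U =
     topology (\<lambda>W. W \<subseteq> X \<and> (\<forall>x\<in>W. eventually (\<lambda>(x', y). x' = x \<longrightarrow> y \<in> W) U))"

lemma openin_uniform_topology:
  "openin (uniform_topology X U) W \<longleftrightarrow>
     W \<subseteq> X \<and> (\<forall>x\<in>W. eventually (\<lambda>(x', y). x' = x \<longrightarrow> y \<in> W) U)"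
proof -
  have "istopology (\<lambda>W. W \<subseteq> X \<and> (\<forall>x\<in>W. eventually (\<lambda>(x', y). x' = x \<longrightarrow> y \<in> W) U))"
    unfolding istopology_def
  proof safe
    fix A B x
    assume "\<forall>x\<in>A. eventually (\<lambda>(x', y). x' = x \<longrightarrow> y \<in> A) U"
      and "\<forall>x\<in>B. eventually (\<lambda>(x', y). x' = x \<longrightarrow> y \<in> B) U" and "x \<in> A" "x \<in> B"
    then have "eventually (\<lambda>(x', y). x' = x \<longrightarrow> y \<in> A) U"
      and "eventually (\<lambda>(x', y). x' = x \<longrightarrow> y \<in> B) U" by auto
    then show "eventually (\<lambda>(x', y). x' = x \<longrightarrow> y \<in> A \<inter> B) U"
      by eventually_elim auto
  next
    fix \<K> x A
    assume "\<forall>W\<in>\<K>. W \<subseteq> X \<and> (\<forall>x\<in>W. eventually (\<lambda>(x', y). x' = x \<longrightarrow> y \<in> W) U)"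
      and "A \<in> \<K>" "x \<in> A"
    then have "eventually (\<lambda>(x', y). x' = x \<longrightarrow> y \<in> A) U" by auto
    then show "eventually (\<lambda>(x', y). x' = x \<longrightarrow> y \<in> \<Union>\<K>) U"
      by eventually_elim (use \<open>A \<in> \<K>\<close> in auto)
  qed auto
  then show ?thesis
    by (simp add: uniform_topology_def)
qed

text \<open>Meaningful when \<open>T\<close> is compact Hausdorff: then there is exactly one such uniformity.\<close>

definition compact_uniformity :: "'a topology \<Rightarrow> ('a \<times> 'a) filter" where
  "compact_uniformity T =
     (THE U. uniformity_on (topspace T) U \<and> uniform_topology (topspace T) U = T)"

section \<open>Cofinite directed graphs and completions\<close>

definition compatible_equiv :: "'a digraph \<Rightarrow> ('a \<times> 'a) set \<Rightarrow> bool" where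
  "compatible_equiv G R \<longleftrightarrow>
     equiv (elems G) R \<and>
     (\<forall>(x, y)\<in>R. (src G x, src G y) \<in> R \<and> (tgt G x, tgt G y) \<in> R)"

definition cofinite_entourage ::
  "'a digraph \<Rightarrow> ('a \<times> 'a) filter \<Rightarrow> ('a \<times> 'a) set \<Rightarrow> bool" where
  "cofinite_entourage G U R \<longleftrightarrow>
     compatible_equiv G R \<and> finite (elems G // R) \<and> entourage (elems G) U R"

definition cofinite_digraph :: "'a digraph \<Rightarrow> ('a \<times> 'a) filter \<Rightarrow> bool" where
  "cofinite_digraph G U \<longleftrightarrow>
     digraph G \<and> uniformity_on (elems G) U \<and>
     Hausdorff_space (uniform_topology (elems G) U) \<and>
     (\<forall>E. entourage (elems G) U E \<longrightarrow> (\<exists>R. cofinite_entourage G U R \<and> R \<subseteq> E))"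

text \<open>
  In the last clause, \<open>inf _ (principal (elems G \<times> elems G))\<close> is the filter generated by the traces
  on \<open>elems G \<times> elems G\<close> of the entourages, that is, the induced uniformity.
\<close>

definition digraph_completion ::
  "'a digraph \<Rightarrow> ('a \<times> 'a) filter \<Rightarrow> 'a digraph \<Rightarrow> 'a topology \<Rightarrow> bool" where
  "digraph_completion G U H T \<longleftrightarrow>
     topological_digraph H T \<and> compact_space T \<and> Hausdorff_space T \<and>
     sub_digraph G H \<and> T closure_of (elems G) = elems H \<and>
     U = inf (compact_uniformity T) (principal (elems G \<times> elems G))"

end

theory Submission
  imports Defs
begin

text \<open>
  The uniformity of a compact Hausdorff space is the filter of neighbourhoods of the diagonal, so
  its entourages among the equivalence relations are the open ones, and these are also closed. A
  clopen equivalence relation on the completion is therefore the closure of its trace on the dense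
  subgraph. Conversely, the closure of a cofinite entourage \<open>R\<close> contains every open \<open>W\<close> whose trace
  lies in \<open>R\<close>, so it is a neighbourhood of the diagonal; transitivity survives because \<open>W\<close> bridges
  nearby points, and each class meets the dense subgraph, which gives finite index. These closures
  separate points, hence by compactness the completion is the limit of its finite quotients.
\<close>

section \<open>The uniformity of a compact Hausdorff space\<close>

text \<open>\<open>compact_uniformity\<close> is a definite description, so nothing can be said
  about it before both existence and uniqueness are known; afterwards the explicit filter
  \<open>diagonal_nhds\<close> replaces it throughout. The uniformity of the dense subgraph is
  visible only through traces, so a cofinite entourage \<open>R\<close> is always accompanied by an
  open \<open>W\<close> around the diagonal with
  \<open>W \<inter> A \<times> A \<subseteq> R\<close>, where \<open>A\<close> is the dense
  subgraph. The claims about the closure of \<open>R\<close> depend on each other in a fixed order: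
  it is an equivalence relation containing \<open>W\<close>, hence it is open, and openness is what
  makes each of its classes meet the dense subgraph. The form of the limit is dictated by
  \<open>profinite_digraph\<close>, which asks for graphs on natural numbers indexed by relations:
  quotient classes are therefore numbered, and the index set consists of the cofinite entourages of
  the completion themselves.\<close>

definition diagonal_nhds :: "'a topology \<Rightarrow> ('a \<times> 'a) filter" where
  "diagonal_nhds T =
     (INF W\<in>{W. openin (prod_topology T T) W \<and> (\<forall>x\<in>topspace T. (x, x) \<in> W)}. principal W)"

text \<open>Defining the filter as an infimum of principal filters makes it a filter for free. Open
  neighbourhoods of the diagonal are closed under binary intersection, so they form a base, and one
  of them suffices as a witness.\<close>

lemma eventually_diagonal_nhds:
  "eventually P (diagonal_nhds T) \<longleftrightarrow>
     (\<exists>W. openin (prod_topology T T) W \<and> (\<forall>x\<in>topspace T. (x, x) \<in> W) \<and> (\<forall>p\<in>W. P p))"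
proof -
  have "eventually P (diagonal_nhds T) \<longleftrightarrow>
    (\<exists>W\<in>{W. openin (prod_topology T T) W \<and> (\<forall>x\<in>topspace T. (x, x) \<in> W)}.
       eventually P (principal W))"
    unfolding diagonal_nhds_def
  proof (rule eventually_INF_base)
    show "{W. openin (prod_topology T T) W \<and> (\<forall>x\<in>topspace T. (x, x) \<in> W)} \<noteq> {}"
      using openin_topspace[of "prod_topology T T"] by (auto simp del: openin_topspace)
  next
    fix V W
    assume "V \<in> {W. openin (prod_topology T T) W \<and> (\<forall>x\<in>topspace T. (x, x) \<in> W)}"
      and "W \<in> {W. openin (prod_topology T T) W \<and> (\<forall>x\<in>topspace T. (x, x) \<in> W)}"
    then show "\<exists>Z\<in>{W. openin (prod_topology T T) W \<and> (\<forall>x\<in>topspace T. (x, x) \<in> W)}.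
        principal Z \<le> inf (principal V) (principal W)"
      by (intro bexI[of _ "V \<inter> W"]) auto
  qed
  then show ?thesis
    by (auto simp: eventually_principal)
qed

section \<open>Squares, finite covers and shrinking of open sets\<close>

lemma openin_prod_topology_square:
  assumes "openin (prod_topology T T) W" "(x, x) \<in> W"
  obtains Q where "openin T Q" "x \<in> Q" "Q \<times> Q \<subseteq> W"
proof -
  obtain P Q where "openin T P" "openin T Q" "x \<in> P" "x \<in> Q" "P \<times> Q \<subseteq> W"
    using assms unfolding openin_prod_topology_alt by meson
  then show thesis
    by (intro that[of "P \<inter> Q"]) auto
qed

lemma compact_space_choose_cover:
  assumes "compact_space T"
    and "\<And>x. x \<in> topspace T \<Longrightarrow> openin T (P x) \<and> x \<in> P x"
  obtains F where "finite F" "F \<subseteq> topspace T" "topspace T \<subseteq> (\<Union>x\<in>F. P x)"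
proof -
  have "\<exists>\<F>. finite \<F> \<and> \<F> \<subseteq> P ` topspace T \<and> topspace T \<subseteq> \<Union>\<F>"
    using assms(1)[unfolded compact_space_alt, rule_format, of "P ` topspace T"] assms(2) by blast
  then obtain \<F> where "finite \<F>" "\<F> \<subseteq> P ` topspace T" "topspace T \<subseteq> \<Union>\<F>"
    by blast
  then show thesis
    using that by (metis finite_subset_image)
qed

lemma regular_space_shrink:
  assumes "regular_space T" "openin T Q" "x \<in> Q"
  obtains P K where "openin T P" "closedin T K" "x \<in> P" "P \<subseteq> K" "K \<subseteq> Q"
  using assms neighbourhood_base_of_closedin[of T]
  unfolding neighbourhood_base_of by meson

text \<open>
  Cover the space by finitely many \<open>P x \<subseteq> K x \<subseteq> Q x\<close> with \<open>K x\<close> closed and \<open>Q x \<times> Q x \<subseteq> W\<close>, and let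
  \<open>V\<close> consist of the pairs that lie, for each \<open>x\<close>, in \<open>Q x \<times> Q x\<close> or avoid \<open>K x\<close> in both
  coordinates: the \<open>x\<close> whose \<open>P x\<close> contains a common middle point forces the first alternative.
\<close>

lemma diagonal_nhds_comp:
  assumes T: "compact_space T" "Hausdorff_space T"
    and W: "openin (prod_topology T T) W" "\<And>x. x \<in> topspace T \<Longrightarrow> (x, x) \<in> W"
  obtains V where "openin (prod_topology T T) V" "\<And>x. x \<in> topspace T \<Longrightarrow> (x, x) \<in> V"
    "\<And>x y z. (x, y) \<in> V \<Longrightarrow> (y, z) \<in> V \<Longrightarrow> (x, z) \<in> W"
proof -
  have reg: "regular_space T"
    using T compact_Hausdorff_imp_regular_space by blast
  have "\<exists>Q P K. openin T Q \<and> openin T P \<and> closedin T K \<and> x \<in> P \<and> P \<subseteq> K \<and> K \<subseteq> Q \<and> Q \<times> Q \<subseteq> W"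
    if x: "x \<in> topspace T" for x
  proof -
    obtain Q where "openin T Q" "x \<in> Q" "Q \<times> Q \<subseteq> W"
      using openin_prod_topology_square[OF W(1) W(2)[OF x]] .
    moreover obtain P K where "openin T P" "closedin T K" "x \<in> P" "P \<subseteq> K" "K \<subseteq> Q"
      using regular_space_shrink[OF reg \<open>openin T Q\<close> \<open>x \<in> Q\<close>] .
    ultimately show ?thesis by blast
  qed
  then obtain Q P K where QPK: "\<And>x. x \<in> topspace T \<Longrightarrow> openin T (Q x) \<and> openin T (P x) \<and>
      closedin T (K x) \<and> x \<in> P x \<and> P x \<subseteq> K x \<and> K x \<subseteq> Q x \<and> Q x \<times> Q x \<subseteq> W"
    by metis
  obtain F where F: "finite F" "F \<subseteq> topspace T" "topspace T \<subseteq> (\<Union>x\<in>F. P x)"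
    using compact_space_choose_cover[OF T(1), of P] QPK by blast
  define B where "B x = Q x \<times> Q x \<union> (topspace T - K x) \<times> (topspace T - K x)" for x
  define V where "V = (topspace T \<times> topspace T) \<inter> (\<Inter>x\<in>F. B x)"
  have B: "openin (prod_topology T T) (B x)" if "x \<in> F" for x
  proof -
    have "openin T (Q x)" "openin T (topspace T - K x)"
      using QPK F(2) that by (auto simp: closedin_def)
    then show ?thesis
      unfolding B_def by (intro openin_Un) (auto simp: openin_prod_Times_iff)
  qed
  have "openin (prod_topology T T) V"
  \<comment> \<open>An intersection over the empty set would be \<open>UNIV\<close>. An empty
    \<open>F\<close> forces the space to be empty, which is allowed.\<close>
  proof (cases "F = {}")
    case True
    then show ?thesis
      using openin_topspace[of "prod_topology T T"] by (simp add: V_def del: openin_topspace)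
  next
    case False
    then have "openin (prod_topology T T) (\<Inter>x\<in>F. B x)"
      using F(1) B by (intro openin_Inter) auto
    then show ?thesis
      using openin_topspace[of "prod_topology T T"]
      by (simp add: V_def openin_Int del: openin_topspace)
  qed
  moreover have "(y, y) \<in> V" if "y \<in> topspace T" for y
  proof -
    have "(y, y) \<in> B x" if "x \<in> F" for x
    proof (cases "y \<in> K x")
      case True
      then show ?thesis
        using QPK[of x] F(2) \<open>x \<in> F\<close> unfolding B_def by blast
    next
      case False
      then show ?thesis
        using \<open>y \<in> topspace T\<close> unfolding B_def by blast
    qed
    then show ?thesis
      using that F(3) by (auto simp: V_def)
  qed
  moreover have "(a, c) \<in> W" if "(a, b) \<in> V" "(b, c) \<in> V" for a b c
  proof -
    have "b \<in> topspace T"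
      using that(1) by (simp add: V_def)
    then obtain x where x: "x \<in> F" "b \<in> P x"
      using F(3) by blast
    then have "b \<in> K x" "Q x \<times> Q x \<subseteq> W"
      using QPK F(2) by blast+
    moreover have "(a, b) \<in> B x" "(b, c) \<in> B x"
      using that x(1) by (auto simp: V_def)
    ultimately show ?thesis
      by (auto simp: B_def)
  qed
  ultimately show thesis
    using that by blast
qed

section \<open>Existence of a uniformity inducing a compact Hausdorff topology\<close>

lemma uniformity_on_diagonal_nhds:
  assumes "compact_space T" "Hausdorff_space T"
  shows "uniformity_on (topspace T) (diagonal_nhds T)"
  unfolding uniformity_on_def
proof (intro conjI allI impI)
  show "diagonal_nhds T \<le> principal (topspace T \<times> topspace T)"
    unfolding le_principal eventually_diagonal_nhds
    using openin_topspace[of "prod_topology T T"]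
    by (intro exI[of _ "topspace T \<times> topspace T"]) (auto simp del: openin_topspace)
next
  fix E assume "eventually E (diagonal_nhds T)"
  then show "\<forall>x\<in>topspace T. E (x, x)"
    by (auto simp: eventually_diagonal_nhds)
next
  fix E assume "eventually E (diagonal_nhds T)"
  then obtain W where W: "openin (prod_topology T T) W"
    "\<forall>x\<in>topspace T. (x, x) \<in> W" "\<forall>p\<in>W. E p"
    by (auto simp: eventually_diagonal_nhds)
  have "continuous_map (prod_topology T T) (prod_topology T T) (\<lambda>(x, y). (y, x))"
    using homeomorphic_imp_continuous_map homeomorphic_map_swap by blast
  then have "openin (prod_topology T T)
      {p \<in> topspace (prod_topology T T). (\<lambda>(x, y). (y, x)) p \<in> W}"
    using W(1) openin_continuous_map_preimage by blast
  then show "eventually (\<lambda>(x, y). E (y, x)) (diagonal_nhds T)"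
    unfolding eventually_diagonal_nhds using W(2,3)
    by (rule_tac exI[of _ "{p \<in> topspace (prod_topology T T). (\<lambda>(x, y). (y, x)) p \<in> W}"]) auto
next
  fix E assume "eventually E (diagonal_nhds T)"
  then obtain W where W: "openin (prod_topology T T) W"
    "\<And>x. x \<in> topspace T \<Longrightarrow> (x, x) \<in> W" "\<forall>p\<in>W. E p"
    by (auto simp: eventually_diagonal_nhds)
  obtain V where "openin (prod_topology T T) V" "\<And>x. x \<in> topspace T \<Longrightarrow> (x, x) \<in> V"
    "\<And>x y z. (x, y) \<in> V \<Longrightarrow> (y, z) \<in> V \<Longrightarrow> (x, z) \<in> W"
    using diagonal_nhds_comp[OF assms W(1,2)] by blast
  then show "\<exists>D. eventually D (diagonal_nhds T) \<and>
      (\<forall>x y z. D (x, y) \<longrightarrow> D (y, z) \<longrightarrow> E (x, z))"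
    using W(3) by (intro exI[of _ "\<lambda>p. p \<in> V"]) (auto simp: eventually_diagonal_nhds)
qed

lemma uniform_topology_diagonal_nhds:
  assumes "Hausdorff_space T"
  shows "uniform_topology (topspace T) (diagonal_nhds T) = T"
  unfolding topology_eq openin_uniform_topology
proof (intro allI iffI conjI ballI)
  fix W
  assume "W \<subseteq> topspace T \<and> (\<forall>x\<in>W. \<forall>\<^sub>F (x', y) in diagonal_nhds T. x' = x \<longrightarrow> y \<in> W)"
  then have W: "W \<subseteq> topspace T" "\<And>x. x \<in> W \<Longrightarrow> \<forall>\<^sub>F (x', y) in diagonal_nhds T. x' = x \<longrightarrow> y \<in> W"
    by auto
  show "openin T W"
  proof (subst openin_subopen, intro ballI)
    fix x assume x: "x \<in> W"
    then obtain V where V: "openin (prod_topology T T) V" "\<forall>x\<in>topspace T. (x, x) \<in> V"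
      "\<forall>p\<in>V. case p of (x', y) \<Rightarrow> x' = x \<longrightarrow> y \<in> W"
      using W(2) unfolding eventually_diagonal_nhds by blast
    have "(x, x) \<in> V"
      using V(2) W(1) x by auto
    then obtain Q where "openin T Q" "x \<in> Q" "Q \<times> Q \<subseteq> V"
      using openin_prod_topology_square[OF V(1)] by blast
    then show "\<exists>Q. openin T Q \<and> x \<in> Q \<and> Q \<subseteq> W"
      using V(3) by blast
  qed
next
  fix W assume "openin T W"
  then show "W \<subseteq> topspace T"
    by (rule openin_subset)
next
  fix W x assume W: "openin T W" and x: "x \<in> W"
  \<comment> \<open>The witness has to constrain the row of \<open>x\<close> only. Removing that row
    leaves \<open>(topspace T - {x}) \<times> topspace T\<close>, which is open because points are
    closed; adding \<open>W \<times> W\<close> restores the row with second coordinate in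
    \<open>W\<close>.\<close>
  have "closedin T {x}"
    using assms W x openin_subset by (metis Hausdorff_imp_t1_space subsetD t1_space_closedin_singleton)
  then have "openin (prod_topology T T) (W \<times> W \<union> (topspace T - {x}) \<times> topspace T)"
    using W by (intro openin_Un) (auto simp: openin_prod_Times_iff)
  then show "\<forall>\<^sub>F (x', y) in diagonal_nhds T. x' = x \<longrightarrow> y \<in> W"
    unfolding eventually_diagonal_nhds using x
    by (intro exI[of _ "W \<times> W \<union> (topspace T - {x}) \<times> topspace T"]) auto
qed

section \<open>Uniqueness of the uniformity inducing a compact topology\<close>

lemma uniformity_onD:
  assumes "uniformity_on X U" "eventually E U"
  shows "x \<in> X \<Longrightarrow> E (x, x)"
    and "eventually (\<lambda>(x, y). E (y, x)) U"
    and "\<exists>D. eventually D U \<and> (\<forall>x y z. D (x, y) \<longrightarrow> D (y, z) \<longrightarrow> E (x, z))"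
  using assms by (auto simp: uniformity_on_def)

text \<open>The section of \<open>E\<close> at \<open>x\<close> need not be open, so
  \<open>Q\<close> is taken to be its interior: the points \<open>y\<close> having some entourage
  whose section at \<open>y\<close> stays inside. If \<open>D\<close> composed with itself refines
  such an entourage, then the whole section of \<open>D\<close> at \<open>y\<close> lies in
  \<open>Q\<close>, so \<open>Q\<close> is open.\<close>

lemma uniform_topology_nhd:
  assumes U: "uniformity_on X U" and E: "eventually E U" and x: "x \<in> X"
  obtains Q where "openin (uniform_topology X U) Q" "x \<in> Q" "\<forall>y\<in>Q. E (x, y)"
proof -
  define Q where "Q = {y \<in> X. \<forall>\<^sub>F (y', z) in U. y' = y \<longrightarrow> z \<in> X \<and> E (x, z)}"
  have X: "\<forall>\<^sub>F p in U. p \<in> X \<times> X"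
    using U by (auto simp: uniformity_on_def le_principal)
  have "openin (uniform_topology X U) Q"
    unfolding openin_uniform_topology
  proof (intro conjI ballI)
    fix y assume "y \<in> Q"
    then have "\<forall>\<^sub>F (y', z) in U. y' = y \<longrightarrow> z \<in> X \<and> E (x, z)"
      by (simp add: Q_def)
    from uniformity_onD(3)[OF U this] obtain D where D: "eventually D U"
      "\<And>a b c. D (a, b) \<Longrightarrow> D (b, c) \<Longrightarrow> a = y \<longrightarrow> c \<in> X \<and> E (x, c)"
      by auto
    have "\<forall>\<^sub>F (a, b) in U. a = y \<longrightarrow> b \<in> X \<and> (\<forall>\<^sub>F (b', c) in U. b' = b \<longrightarrow> c \<in> X \<and> E (x, c))"
      using X D(1)
    proof eventually_elim
      case (elim p)
      show ?case
      proof (clarify, intro conjI)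
        fix b assume p: "p = (y, b)"
        then show "b \<in> X" using elim by auto
        show "\<forall>\<^sub>F (b', c) in U. b' = b \<longrightarrow> c \<in> X \<and> E (x, c)"
          using D(1) by eventually_elim (use elim p D(2) in auto)
      qed
    qed
    then show "\<forall>\<^sub>F (a, b) in U. a = y \<longrightarrow> b \<in> Q"
      by (simp add: Q_def)
  qed (auto simp: Q_def)
  moreover have "x \<in> Q"
  proof -
    have "\<forall>\<^sub>F (y', z) in U. y' = x \<longrightarrow> z \<in> X \<and> E (x, z)"
      using X E by eventually_elim auto
    then show ?thesis
      using x by (simp add: Q_def)
  qed
  moreover have "E (x, y)" if "y \<in> Q" for y
    using that uniformity_onD(1)[OF U, of "\<lambda>(y', z). y' = y \<longrightarrow> z \<in> X \<and> E (x, z)" y]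
    by (auto simp: Q_def)
  ultimately show thesis
    using that by blast
qed

text \<open>The order of filters reverses inclusion of bases: the first half shows that every
  entourage contains an open neighbourhood of the diagonal, the second that every open neighbourhood
  of the diagonal is an entourage. Compactness enters in the second, where only finitely many local
  entourages may be intersected.\<close>

lemma uniformity_on_eq_diagonal_nhds:
  assumes U: "uniformity_on X U" and T: "uniform_topology X U = T" "topspace T = X"
    and compact: "compact_space T"
  shows "U = diagonal_nhds T"
proof (rule antisym)
  show "diagonal_nhds T \<le> U"
  proof (rule filter_leI)
    fix E assume "eventually E U"
    from uniformity_onD(3)[OF U this] obtain D
      where D: "eventually D U" "\<And>x y z. D (x, y) \<Longrightarrow> D (y, z) \<Longrightarrow> E (x, z)"
      by blast
    \<comment> \<open>Symmetrizing makes \<open>x\<close> a bridge: for \<open>y\<close> and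
      \<open>z\<close> in \<open>Q x\<close> both \<open>D (y, x)\<close> and
      \<open>D (x, z)\<close> hold, so the square of \<open>Q x\<close> lies in
      \<open>E\<close>.\<close>
    have D': "eventually (\<lambda>(x, y). D (x, y) \<and> D (y, x)) U"
      using D(1) uniformity_onD(2)[OF U D(1)] by eventually_elim auto
    have "\<exists>Q. openin T Q \<and> x \<in> Q \<and> (\<forall>y\<in>Q. D (x, y) \<and> D (y, x))" if x: "x \<in> X" for x
    proof -
      obtain P where "openin T P" "x \<in> P" "\<forall>y\<in>P. D (x, y) \<and> D (y, x)"
        using uniform_topology_nhd[OF U D' x, unfolded T(1) prod.case] .
      then show ?thesis
        by blast
    qed
    then obtain Q where Q: "\<And>x. x \<in> X \<Longrightarrow> openin T (Q x) \<and> x \<in> Q x \<and> (\<forall>y\<in>Q x. D (x, y) \<and> D (y, x))"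
      by metis
    have "openin (prod_topology T T) (\<Union>x\<in>X. Q x \<times> Q x)"
      using Q by (intro openin_Union) (auto simp: openin_prod_Times_iff)
    moreover have "(x, x) \<in> (\<Union>x\<in>X. Q x \<times> Q x)" if "x \<in> topspace T" for x
      using that Q[of x] T(2) by auto
    moreover have "E p" if "p \<in> (\<Union>x\<in>X. Q x \<times> Q x)" for p
    proof -
      obtain x y z where p: "p = (y, z)" "x \<in> X" "y \<in> Q x" "z \<in> Q x"
        using \<open>p \<in> _\<close> by auto
      then have "D (y, x)" "D (x, z)"
        using Q[of x] by simp_all
      then show ?thesis
        using D(2) p(1) by simp
    qed
    ultimately show "eventually E (diagonal_nhds T)"
      unfolding eventually_diagonal_nhds by blast
  qed
  show "U \<le> diagonal_nhds T"
    unfolding diagonal_nhds_def le_INF_iff le_principal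
  proof safe
    fix W assume W: "openin (prod_topology T T) W" "\<forall>x\<in>topspace T. (x, x) \<in> W"
    \<comment> \<open>One entourage \<open>D\<close> must serve all starting points \<open>y\<close>
      in a neighbourhood \<open>P\<close> of \<open>x\<close>, not just \<open>x\<close> itself;
      then a finite cover by such \<open>P\<close> leaves finitely many \<open>D\<close>.\<close>
    have "\<exists>P D. openin T P \<and> x \<in> P \<and> eventually D U \<and> (\<forall>y\<in>P. \<forall>z. D (y, z) \<longrightarrow> (y, z) \<in> W)"
      if x: "x \<in> X" for x
    proof -
      have xT: "x \<in> topspace T"
        using x T(2) by simp
      obtain Q where Q: "openin T Q" "x \<in> Q" "Q \<times> Q \<subseteq> W"
        using openin_prod_topology_square[OF W(1) W(2)[rule_format, OF xT]] .
      have "\<forall>\<^sub>F (x', y) in U. x' = x \<longrightarrow> y \<in> Q"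
        using Q(1,2) unfolding T(1)[symmetric] openin_uniform_topology by simp
      from uniformity_onD(3)[OF U this] obtain D where D: "eventually D U"
        "\<And>a b c. D (a, b) \<Longrightarrow> D (b, c) \<Longrightarrow> a = x \<longrightarrow> c \<in> Q"
        by auto
      obtain P where P: "openin T P" "x \<in> P" "\<forall>y\<in>P. D (x, y)"
        using uniform_topology_nhd[OF U D(1) x, unfolded T(1)] .
      have "(y, z) \<in> W" if y: "y \<in> P" and yz: "D (y, z)" for y z
      proof -
        have "y \<in> X"
          using y P(1) openin_subset T(2) by blast
        \<comment> \<open>Two \<open>D\<close>-steps from \<open>x\<close> end in \<open>Q\<close>.
          The path through \<open>y\<close> to \<open>z\<close> puts \<open>z\<close> there, and the
          reflexive step at \<open>y\<close> puts \<open>y\<close> itself there.\<close>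
        then have "D (y, y)"
          using uniformity_onD(1)[OF U D(1)] by blast
        then have "y \<in> Q" "z \<in> Q"
          using D(2)[OF P(3)[rule_format, OF y]] yz by simp_all
        then show ?thesis
          using Q(3) by blast
      qed
      then show ?thesis
        using P(1,2) D(1) by blast
    qed
    then obtain P D where PD: "\<And>x. x \<in> X \<Longrightarrow> openin T (P x) \<and> x \<in> P x \<and> eventually (D x) U \<and>
        (\<forall>y\<in>P x. \<forall>z. D x (y, z) \<longrightarrow> (y, z) \<in> W)"
      by metis
    have cover: "openin T (P x) \<and> x \<in> P x" if "x \<in> topspace T" for x
      using PD[of x] that T(2) by simp
    obtain F where F: "finite F" "F \<subseteq> X" "X \<subseteq> (\<Union>x\<in>F. P x)"
      by (rule compact_space_choose_cover[OF compact cover, unfolded T(2)])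
    have "\<forall>\<^sub>F p in U. \<forall>x\<in>F. D x p"
      using F(1,2) PD by (intro eventually_ball_finite) auto
    moreover have "\<forall>\<^sub>F p in U. p \<in> X \<times> X"
      using U by (auto simp: uniformity_on_def le_principal)
    ultimately show "\<forall>\<^sub>F p in U. p \<in> W"
    proof eventually_elim
      case (elim p)
      then obtain y z where p: "p = (y, z)" "y \<in> X"
        by auto
      then obtain x where x: "x \<in> F" "y \<in> P x"
        using F(3) by blast
      then have "D x (y, z)" "x \<in> X"
        using elim p(1) F(2) by auto
      then show ?case
        using PD[of x] x(2) p(1) by simp
    qed
  qed
qed

lemma compact_uniformity_eq_diagonal_nhds:
  assumes "compact_space T" "Hausdorff_space T"
  shows "compact_uniformity T = diagonal_nhds T"
  unfolding compact_uniformity_def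
proof (rule the_equality)
  show "uniformity_on (topspace T) (diagonal_nhds T) \<and>
      uniform_topology (topspace T) (diagonal_nhds T) = T"
    using uniformity_on_diagonal_nhds[OF assms] uniform_topology_diagonal_nhds[OF assms(2)] by simp
next
  fix U assume "uniformity_on (topspace T) U \<and> uniform_topology (topspace T) U = T"
  then show "U = diagonal_nhds T"
    using uniformity_on_eq_diagonal_nhds[of "topspace T" U T] assms(1) by simp
qed

section \<open>Cofinite entourages of a compact directed graph\<close>

text \<open>Transitivity spreads a neighbourhood of the diagonal to all of \<open>S\<close>: for
  \<open>(x, y) \<in> S\<close>, points \<open>a\<close> near \<open>x\<close> and \<open>b\<close>
  near \<open>y\<close> are joined by the chain \<open>a, x, y, b\<close>, whose outer links lie in
  \<open>W\<close>.\<close>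

lemma equiv_entourage_iff_openin:
  assumes "equiv (topspace T) S"
  shows "entourage (topspace T) (diagonal_nhds T) S \<longleftrightarrow> openin (prod_topology T T) S"
proof
  assume "entourage (topspace T) (diagonal_nhds T) S"
  then obtain W where W: "openin (prod_topology T T) W" "\<And>x. x \<in> topspace T \<Longrightarrow> (x, x) \<in> W" "W \<subseteq> S"
    unfolding entourage_def eventually_diagonal_nhds by blast
  have S: "sym S" "trans S" "S \<subseteq> topspace T \<times> topspace T"
    using assms by (auto simp: equiv_def refl_on_def)
  show "openin (prod_topology T T) S"
    unfolding openin_prod_topology_alt
  proof (intro allI impI)
    fix x y assume xy: "(x, y) \<in> S"
    then have "x \<in> topspace T" "y \<in> topspace T"
      using S(3) by auto
    obtain P where P: "openin T P" "x \<in> P" "P \<times> P \<subseteq> W"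
      using openin_prod_topology_square[OF W(1) W(2)[OF \<open>x \<in> topspace T\<close>]] .
    obtain Q where Q: "openin T Q" "y \<in> Q" "Q \<times> Q \<subseteq> W"
      using openin_prod_topology_square[OF W(1) W(2)[OF \<open>y \<in> topspace T\<close>]] .
    have "(a, b) \<in> S" if "a \<in> P" "b \<in> Q" for a b
    proof -
      have "(a, x) \<in> S" "(y, b) \<in> S"
        using that P Q W(3) by blast+
      with xy show ?thesis
        using S(2) by (meson transD)
    qed
    then show "\<exists>P Q. openin T P \<and> openin T Q \<and> x \<in> P \<and> y \<in> Q \<and> P \<times> Q \<subseteq> S"
      using P Q by blast
  qed
next
  assume "openin (prod_topology T T) S"
  moreover have "\<forall>x\<in>topspace T. (x, x) \<in> S" "S \<subseteq> topspace T \<times> topspace T"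
    using assms by (auto simp: equiv_def refl_on_def)
  ultimately show "entourage (topspace T) (diagonal_nhds T) S"
    unfolding entourage_def eventually_diagonal_nhds by blast
qed

lemma openin_equiv_class:
  assumes "openin (prod_topology T T) S" "equiv (topspace T) S" "x \<in> topspace T"
  shows "openin T (S `` {x})"
proof -
  have S: "S \<subseteq> topspace T \<times> topspace T"
    using assms(2) by (auto simp: equiv_def refl_on_def)
  have "continuous_map T (prod_topology T T) (\<lambda>y. (x, y))"
    using assms(3) by (simp add: continuous_map_pairwise o_def)
  then have "openin T {y \<in> topspace T. (x, y) \<in> S}"
    using assms(1) openin_continuous_map_preimage by blast
  moreover have "{y \<in> topspace T. (x, y) \<in> S} = S `` {x}"
    using S by auto
  ultimately show ?thesis
    by simp
qed

text \<open>The complement is a union of products of two distinct classes, and classes of an open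
  equivalence relation are open.\<close>

lemma closedin_open_equiv:
  assumes "openin (prod_topology T T) S" "equiv (topspace T) S"
  shows "closedin (prod_topology T T) S"
  unfolding closedin_def
proof (intro conjI)
  show "openin (prod_topology T T) (topspace (prod_topology T T) - S)"
    unfolding openin_prod_topology_alt
  proof (intro allI impI)
    fix x y assume xy: "(x, y) \<in> topspace (prod_topology T T) - S"
    have S: "sym S" "trans S" "refl_on (topspace T) S" "S \<subseteq> topspace T \<times> topspace T"
      using assms by (auto simp: equiv_def refl_on_def)
    have "openin T (S `` {x})" "openin T (S `` {y})"
      using xy openin_equiv_class[OF assms] by auto
    moreover have "x \<in> S `` {x}" "y \<in> S `` {y}"
      using xy S(3) by (auto simp: refl_on_def)
    moreover have "S `` {x} \<times> S `` {y} \<subseteq> topspace (prod_topology T T) - S"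
    proof safe
      fix a b assume ab: "(x, a) \<in> S" "(y, b) \<in> S"
      then show "(a, b) \<in> topspace (prod_topology T T)"
        using S(4) by auto
      assume "(a, b) \<in> S"
      then have "(x, y) \<in> S"
        using ab S(1,2) by (meson symD transD)
      then show False using xy by auto
    qed
    ultimately show "\<exists>P Q. openin T P \<and> openin T Q \<and> x \<in> P \<and> y \<in> Q \<and>
        P \<times> Q \<subseteq> topspace (prod_topology T T) - S"
      by blast
  qed
qed (use assms openin_subset in blast)

section \<open>Intersections of cofinite entourages\<close>

lemma digraph_verts_mem: "digraph G \<Longrightarrow> x \<in> elems G \<Longrightarrow> src G x \<in> elems G \<and> tgt G x \<in> elems G"
  by (auto simp: digraph_def)

lemma compatible_equiv_Int:
  assumes "compatible_equiv G R" "compatible_equiv G S"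
  shows "compatible_equiv G (R \<inter> S)"
proof -
  have "equiv (elems G) R" "equiv (elems G) S"
    using assms by (auto simp: compatible_equiv_def)
  then have "equiv (elems G) (R \<inter> S)"
    by (auto simp: equiv_def refl_on_def intro: sym_Int trans_Int)
  then show ?thesis
    using assms by (auto simp: compatible_equiv_def)
qed

lemma finite_quotient_Int:
  assumes "finite (X // R)" "finite (X // S)"
  shows "finite (X // (R \<inter> S))"
proof (rule finite_subset)
  \<comment> \<open>Every class of \<open>R \<inter> S\<close> is a class of \<open>R\<close>
    intersected with a class of \<open>S\<close>, so pairs of classes bound the index.\<close>
  show "X // (R \<inter> S) \<subseteq> (\<lambda>(C, D). C \<inter> D) ` ((X // R) \<times> (X // S))"
  proof
    fix C assume "C \<in> X // (R \<inter> S)"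
    then obtain x where x: "x \<in> X" "C = (R \<inter> S) `` {x}"
      by (rule quotientE)
    then have "C = (\<lambda>(C, D). C \<inter> D) (R `` {x}, S `` {x})"
      by auto
    then show "C \<in> (\<lambda>(C, D). C \<inter> D) ` ((X // R) \<times> (X // S))"
      using x(1) quotientI[of x X] by (intro image_eqI[of _ _ "(R `` {x}, S `` {x})"]) auto
  qed
qed (use assms in simp)

lemma entourage_Int:
  assumes "entourage X U R" "entourage X U S"
  shows "entourage X U (R \<inter> S)"
  using assms by (auto simp: entourage_def intro: eventually_conj)

lemma cofinite_entourage_Int:
  assumes "cofinite_entourage G U R" "cofinite_entourage G U S"
  shows "cofinite_entourage G U (R \<inter> S)"
  using assms compatible_equiv_Int finite_quotient_Int entourage_Int
  unfolding cofinite_entourage_def by blast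

section \<open>Closures of cofinite entourages\<close>

lemma closure_of_prod_topologyE:
  assumes "(x, y) \<in> prod_topology T T closure_of R" "openin T P" "openin T Q" "x \<in> P" "y \<in> Q"
  obtains a b where "(a, b) \<in> R" "a \<in> P" "b \<in> Q"
proof -
  have "openin (prod_topology T T) (P \<times> Q)" "(x, y) \<in> P \<times> Q"
    using assms by (auto simp: openin_prod_Times_iff)
  then have "\<exists>p. p \<in> R \<and> p \<in> P \<times> Q"
    using assms(1)[unfolded in_closure_of, THEN conjunct2, THEN spec, of "P \<times> Q"] by simp
  then show thesis
    using that by auto
qed

lemma closure_of_prod_topologyI:
  assumes "x \<in> topspace T" "y \<in> topspace T"
    and R: "\<And>P Q. openin T P \<Longrightarrow> openin T Q \<Longrightarrow> x \<in> P \<Longrightarrow> y \<in> Q \<Longrightarrow>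
      \<exists>a b. (a, b) \<in> R \<and> a \<in> P \<and> b \<in> Q"
  shows "(x, y) \<in> prod_topology T T closure_of R"
  unfolding in_closure_of
proof (intro conjI allI impI)
  fix N assume N: "(x, y) \<in> N \<and> openin (prod_topology T T) N"
  have "\<exists>P Q. openin T P \<and> openin T Q \<and> x \<in> P \<and> y \<in> Q \<and> P \<times> Q \<subseteq> N"
    using N[THEN conjunct2, unfolded openin_prod_topology_alt, rule_format, OF N[THEN conjunct1]] .
  then obtain P Q where PQ: "openin T P" "openin T Q" "x \<in> P" "y \<in> Q" "P \<times> Q \<subseteq> N"
    by auto
  obtain a b where "(a, b) \<in> R" "a \<in> P" "b \<in> Q"
    using R[OF PQ(1-4)] by auto
  then show "\<exists>p. p \<in> R \<and> p \<in> N"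
    using PQ(5) by (intro exI[of _ "(a, b)"]) auto
qed (use assms in simp)

lemma closure_of_prod_topology_topspace:
  assumes "(x, y) \<in> prod_topology T T closure_of R"
  shows "x \<in> topspace T" "y \<in> topspace T"
  using assms by (simp_all add: in_closure_of)

text \<open>Used with \<open>src\<close> and \<open>tgt\<close> to carry compatibility over to the
  closure: an open rectangle around \<open>(f x, f y)\<close> pulls back along \<open>f\<close>, the
  preimage contains a pair of \<open>R\<close>, and its image is again a pair of
  \<open>R\<close>.\<close>

lemma closure_of_relation_map:
  assumes f: "continuous_map T T f"
    and R: "\<And>a b. (a, b) \<in> R \<Longrightarrow> (f a, f b) \<in> R"
    and xy: "(x, y) \<in> prod_topology T T closure_of R"
  shows "(f x, f y) \<in> prod_topology T T closure_of R"
proof (rule closure_of_prod_topologyI)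
  have x: "x \<in> topspace T" "y \<in> topspace T"
    using closure_of_prod_topology_topspace[OF xy] .
  then show "f x \<in> topspace T" "f y \<in> topspace T"
    using f by (auto simp: continuous_map_def)
  fix P Q assume PQ: "openin T P" "openin T Q" "f x \<in> P" "f y \<in> Q"
  have "openin T {a \<in> topspace T. f a \<in> P}" "openin T {a \<in> topspace T. f a \<in> Q}"
    using openin_continuous_map_preimage[OF f] PQ(1,2) by simp_all
  moreover have "x \<in> {a \<in> topspace T. f a \<in> P}" "y \<in> {a \<in> topspace T. f a \<in> Q}"
    using x PQ by auto
  ultimately obtain a b where "(a, b) \<in> R" "a \<in> {a \<in> topspace T. f a \<in> P}"
      "b \<in> {a \<in> topspace T. f a \<in> Q}"
    by (rule closure_of_prod_topologyE[OF xy])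
  then show "\<exists>a b. (a, b) \<in> R \<and> a \<in> P \<and> b \<in> Q"
    using R[OF \<open>(a, b) \<in> R\<close>] by (intro exI[of _ "f a"] exI[of _ "f b"]) simp
qed

text \<open>An open set lies in the closure of its trace on a dense set, and
  \<open>A \<times> A\<close> is dense because closure commutes with products. This serves both
  directions of the correspondence: it puts \<open>W\<close> inside the closure of \<open>R\<close>,
  and it recovers an open relation from its trace.\<close>

lemma openin_subset_closure_of_dense_square:
  assumes "openin (prod_topology T T) W" "T closure_of A = topspace T"
  shows "W \<subseteq> prod_topology T T closure_of (W \<inter> A \<times> A)"
proof -
  have "W \<inter> prod_topology T T closure_of (A \<times> A) \<subseteq> prod_topology T T closure_of (W \<inter> A \<times> A)"
    using assms(1) by (rule openin_Int_closure_of_subset)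
  moreover have "W \<subseteq> prod_topology T T closure_of (A \<times> A)"
    using openin_subset[OF assms(1)] by (simp add: closure_of_Times assms(2))
  ultimately show ?thesis
    by blast
qed

text \<open>
  Any two points of \<open>A\<close> that are close to the same point \<open>y\<close> of the space are \<open>W\<close>-related, hence
  \<open>R\<close>-related; this bridges \<open>x, y\<close> and \<open>y, z\<close> for transitivity.
\<close>

lemma equiv_closure_of:
  assumes R: "equiv A R" and A: "T closure_of A = topspace T"
    and W: "openin (prod_topology T T) W" "\<forall>x\<in>topspace T. (x, x) \<in> W" "W \<inter> A \<times> A \<subseteq> R"
  shows "equiv (topspace T) (prod_topology T T closure_of R)" (is "equiv _ ?C")
proof (rule equivI)
  have R': "sym R" "trans R" "R \<subseteq> A \<times> A"
    using R by (auto simp: equiv_def)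
  show "?C \<subseteq> topspace T \<times> topspace T"
    using closure_of_prod_topology_topspace by auto
  \<comment> \<open>Reflexivity of \<open>R\<close> covers only the points of \<open>A\<close>; at
    the remaining points it has to come from the diagonal inside \<open>W\<close>.\<close>
  have "W \<subseteq> ?C"
    using openin_subset_closure_of_dense_square[OF W(1) A] closure_of_mono[OF W(3)] by (rule order_trans)
  then show "refl_on (topspace T) ?C"
    using W(2) by (auto simp: refl_on_def)
  show "sym ?C"
  proof (rule symI)
    fix x y assume xy: "(x, y) \<in> ?C"
    show "(y, x) \<in> ?C"
    proof (rule closure_of_prod_topologyI)
      fix P Q assume PQ: "openin T P" "openin T Q" "y \<in> P" "x \<in> Q"
      obtain a b where "(a, b) \<in> R" "a \<in> Q" "b \<in> P"
        using closure_of_prod_topologyE[OF xy PQ(2,1,4,3)] .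
      then show "\<exists>a b. (a, b) \<in> R \<and> a \<in> P \<and> b \<in> Q"
        using symD[OF R'(1)] by (intro exI[of _ b] exI[of _ a]) simp
    qed (rule closure_of_prod_topology_topspace[OF xy])+
  qed
  show "trans ?C"
  proof (rule transI)
    fix x y z assume xy: "(x, y) \<in> ?C" and yz: "(y, z) \<in> ?C"
    obtain B where B: "openin T B" "y \<in> B" "B \<times> B \<subseteq> W"
      using openin_prod_topology_square[OF W(1)]
        W(2)[rule_format, OF closure_of_prod_topology_topspace(2)[OF xy]] .
    show "(x, z) \<in> ?C"
    proof (rule closure_of_prod_topologyI)
      fix P Q assume PQ: "openin T P" "openin T Q" "x \<in> P" "z \<in> Q"
      obtain a b where ab: "(a, b) \<in> R" "a \<in> P" "b \<in> B"
        using closure_of_prod_topologyE[OF xy PQ(1) B(1) PQ(3) B(2)] .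
      obtain c d where cd: "(c, d) \<in> R" "c \<in> B" "d \<in> Q"
        using closure_of_prod_topologyE[OF yz B(1) PQ(2) B(2) PQ(4)] .
      have "(b, c) \<in> W \<inter> A \<times> A"
        using ab cd B(3) R'(3) by auto
      then have "(b, c) \<in> R"
        using W(3) by auto
      then have "(a, d) \<in> R"
        using transD[OF R'(2)] ab(1) cd(1) by metis
      then show "\<exists>a b. (a, b) \<in> R \<and> a \<in> P \<and> b \<in> Q"
        using ab(2) cd(3) by auto
    qed (rule closure_of_prod_topology_topspace(1)[OF xy] closure_of_prod_topology_topspace(2)[OF yz])+
  qed
qed

lemma finite_quotient_closure_of:
  assumes R: "equiv A R" "finite (A // R)" and A: "T closure_of A = topspace T" "A \<subseteq> topspace T"
    and S: "equiv (topspace T) S" "openin (prod_topology T T) S" "R \<subseteq> S"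
  shows "finite (topspace T // S)"
proof (rule finite_subset)
  show "topspace T // S \<subseteq> (\<lambda>C. S `` C) ` (A // R)"
  proof
    fix C assume "C \<in> topspace T // S"
    then obtain x where x: "x \<in> topspace T" "C = S `` {x}"
      by (rule quotientE)
    have "openin T (S `` {x})" "x \<in> S `` {x}"
      using openin_equiv_class[OF S(2,1) x(1)] equiv_class_self[OF S(1) x(1)] by auto
    moreover have "x \<in> T closure_of A"
      using x(1) A(1) by simp
    ultimately obtain a where a: "a \<in> A" "(x, a) \<in> S"
      unfolding in_closure_of by blast
    have "S `` (R `` {a}) = S `` {a}"
    proof
      show "S `` (R `` {a}) \<subseteq> S `` {a}"
        using S(1,3) by (auto simp: equiv_def dest: transD)
      show "S `` {a} \<subseteq> S `` (R `` {a})"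
        using equiv_class_self[OF R(1) a(1)] by blast
    qed
    also have "S `` {a} = C"
      using equiv_class_eq[OF S(1) a(2)] x(2) by simp
    finally show "C \<in> (\<lambda>C. S `` C) ` (A // R)"
      using a(1) by (metis image_eqI quotientI)
  qed
qed (use R(2) in simp)

lemma topological_digraph_continuous_map:
  assumes "topological_digraph G T"
  shows "continuous_map T T (src G)" "continuous_map T T (tgt G)"
  using assms by (auto simp: topological_digraph_def continuous_map_in_subtopology)

lemma cofinite_entourage_closure_of:
  assumes H: "topological_digraph H T" and G: "sub_digraph G H" and A: "T closure_of elems G = elems H"
    and R: "cofinite_entourage G (inf (diagonal_nhds T) (principal (elems G \<times> elems G))) R"
  shows "cofinite_entourage H (diagonal_nhds T) (prod_topology T T closure_of R)"
    (is "cofinite_entourage _ _ ?C")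
proof -
  have X: "topspace T = elems H" "elems G \<subseteq> elems H"
    using H G by (auto simp: topological_digraph_def sub_digraph_def)
  have R1: "equiv (elems G) R" "finite (elems G // R)"
    and R2: "\<And>x y. (x, y) \<in> R \<Longrightarrow> (src G x, src G y) \<in> R \<and> (tgt G x, tgt G y) \<in> R"
    using R by (auto simp: cofinite_entourage_def compatible_equiv_def)
  have R3: "R \<subseteq> elems G \<times> elems G"
    using R1(1) by (auto simp: equiv_def)
  \<comment> \<open>Membership in the infimum with a principal filter becomes an implication, which
    says exactly that some neighbourhood of the diagonal has its trace inside
    \<open>R\<close>.\<close>
  have "\<forall>\<^sub>F p in diagonal_nhds T. p \<in> elems G \<times> elems G \<longrightarrow> p \<in> R"
    using R by (simp add: cofinite_entourage_def entourage_def eventually_inf_principal)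
  then obtain W where W: "openin (prod_topology T T) W" "\<forall>x\<in>topspace T. (x, x) \<in> W"
    "\<forall>p\<in>W. p \<in> elems G \<times> elems G \<longrightarrow> p \<in> R"
    unfolding eventually_diagonal_nhds by auto
  then have WR: "W \<inter> elems G \<times> elems G \<subseteq> R"
    by blast
  have A': "T closure_of elems G = topspace T"
    using A X by simp
  have C: "equiv (topspace T) ?C"
    by (rule equiv_closure_of[OF R1(1) A' W(1,2) WR])
  have "W \<subseteq> ?C"
    using openin_subset_closure_of_dense_square[OF W(1) A'] closure_of_mono[OF WR] by (rule order_trans)
  moreover have "?C \<subseteq> topspace T \<times> topspace T"
    using C by (simp add: equiv_def)
  ultimately have ent: "entourage (topspace T) (diagonal_nhds T) ?C"
    unfolding entourage_def eventually_diagonal_nhds using W(1,2) by (intro conjI exI[of _ W]) auto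
  \<comment> \<open>Being an entourage turns into openness only now that the closure is known to be
    an equivalence relation; the finite index below relies on this.\<close>
  have open_C: "openin (prod_topology T T) ?C"
    using ent equiv_entourage_iff_openin[OF C] by simp
  have "R \<subseteq> ?C"
    using R3 X by (intro closure_of_subset) auto
  then have "finite (topspace T // ?C)"
    using finite_quotient_closure_of[OF R1 A' _ C open_C] X by auto
  moreover have "(src H x, src H y) \<in> ?C \<and> (tgt H x, tgt H y) \<in> ?C" if "(x, y) \<in> ?C" for x y
  proof -
    have "(src H a, src H b) \<in> R \<and> (tgt H a, tgt H b) \<in> R" if "(a, b) \<in> R" for a b
    proof -
      have "a \<in> elems G" "b \<in> elems G"
        using that R3 by auto
      then show ?thesis
        using R2[OF that] G by (simp add: sub_digraph_def)
    qed
    then show ?thesis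
      using closure_of_relation_map[OF topological_digraph_continuous_map(1)[OF H] _ that]
        closure_of_relation_map[OF topological_digraph_continuous_map(2)[OF H] _ that]
      by simp
  qed
  ultimately show ?thesis
    using C ent X(1) by (auto simp: cofinite_entourage_def compatible_equiv_def)
qed

section \<open>Traces on the dense subgraph and separation of points\<close>

lemma equiv_restrict:
  assumes "equiv X S" "A \<subseteq> X"
  shows "equiv A (S \<inter> A \<times> A)"
proof (rule equivI)
  have S: "sym S" "trans S" "refl_on X S"
    using assms(1) by (auto simp: equiv_def)
  show "refl_on A (S \<inter> A \<times> A)"
    using S(3) assms(2) by (auto simp: refl_on_def)
  show "sym (S \<inter> A \<times> A)"
    using S(1) by (auto intro!: symI dest: symD)
  show "trans (S \<inter> A \<times> A)"
    using S(2) by (auto intro!: transI dest: transD)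
qed auto

lemma cofinite_entourage_restrict:
  assumes G: "sub_digraph G H" and S: "cofinite_entourage H U S"
  shows "cofinite_entourage G (inf U (principal (elems G \<times> elems G))) (S \<inter> elems G \<times> elems G)"
    (is "cofinite_entourage _ _ ?R")
proof -
  have G': "digraph G" "elems G \<subseteq> elems H"
    "\<And>x. x \<in> elems G \<Longrightarrow> src G x = src H x \<and> tgt G x = tgt H x"
    using G by (auto simp: sub_digraph_def)
  have S': "equiv (elems H) S" "finite (elems H // S)" "eventually (\<lambda>p. p \<in> S) U"
    "\<And>x y. (x, y) \<in> S \<Longrightarrow> (src H x, src H y) \<in> S \<and> (tgt H x, tgt H y) \<in> S"
    using S by (auto simp: cofinite_entourage_def compatible_equiv_def entourage_def)
  have "(src G x, src G y) \<in> ?R \<and> (tgt G x, tgt G y) \<in> ?R" if "(x, y) \<in> ?R" for x y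
  proof -
    have xy: "x \<in> elems G" "y \<in> elems G" "(x, y) \<in> S"
      using that by auto
    show ?thesis
      using S'(4)[OF xy(3)] digraph_verts_mem[OF G'(1) xy(1)] digraph_verts_mem[OF G'(1) xy(2)]
        G'(3)[OF xy(1)] G'(3)[OF xy(2)] by simp
  qed
  then have "compatible_equiv G ?R"
    using equiv_restrict[OF S'(1) G'(2)] by (auto simp: compatible_equiv_def)
  moreover have "finite (elems G // ?R)"
  proof (rule finite_subset)
    show "elems G // ?R \<subseteq> (\<lambda>C. C \<inter> elems G) ` (elems H // S)"
    proof
      fix C assume "C \<in> elems G // ?R"
      then obtain x where x: "x \<in> elems G" "C = ?R `` {x}"
        by (rule quotientE)
      then have "C = S `` {x} \<inter> elems G"
        by auto
      then show "C \<in> (\<lambda>C. C \<inter> elems G) ` (elems H // S)"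
        using x(1) G'(2) quotientI[of x "elems H" S] by blast
    qed
  qed (use S'(2) in simp)
  moreover have "entourage (elems G) (inf U (principal (elems G \<times> elems G))) ?R"
    using S'(3) by (auto simp: entourage_def eventually_inf_principal elim: eventually_mono)
  ultimately show ?thesis
    by (simp add: cofinite_entourage_def)
qed

text \<open>Closedness of \<open>S\<close> gives one inclusion, openness together with density of
  \<open>A\<close> the other.\<close>

lemma closure_of_restrict_open_equiv:
  assumes "openin (prod_topology T T) S" "equiv (topspace T) S" "T closure_of A = topspace T"
  shows "prod_topology T T closure_of (S \<inter> A \<times> A) = S"
proof
  show "prod_topology T T closure_of (S \<inter> A \<times> A) \<subseteq> S"
    using closedin_open_equiv[OF assms(1,2)] by (intro closure_of_minimal) auto
  show "S \<subseteq> prod_topology T T closure_of (S \<inter> A \<times> A)"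
    using openin_subset_closure_of_dense_square[OF assms(1,3)] .
qed

text \<open>The neighbourhood is wanted closed so that it still contains the closure of any relation
  inside it. The square is compact Hausdorff, hence regular, and its diagonal is closed;
  \<open>E\<close> is the complement of an open set around \<open>(x, y)\<close> that is disjoint
  from a neighbourhood of the diagonal.\<close>

lemma closedin_diagonal_nhd_avoiding:
  assumes T: "compact_space T" "Hausdorff_space T"
    and xy: "x \<in> topspace T" "y \<in> topspace T" "x \<noteq> y"
  obtains E where "closedin (prod_topology T T) E" "eventually (\<lambda>p. p \<in> E) (diagonal_nhds T)"
    "(x, y) \<notin> E"
proof -
  let ?D = "(\<lambda>x. (x, x)) ` topspace T"
  have "regular_space (prod_topology T T)"
    using T by (intro compact_Hausdorff_imp_regular_space)
      (auto simp: compact_space_prod_topology Hausdorff_space_prod_topology)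
  moreover have "closedin (prod_topology T T) ?D"
    using T(2) Hausdorff_space_closedin_diagonal by blast
  moreover have "(x, y) \<in> topspace (prod_topology T T) - ?D"
    using xy by auto
  ultimately obtain V W where VW: "openin (prod_topology T T) V" "openin (prod_topology T T) W"
    "(x, y) \<in> V" "?D \<subseteq> W" "disjnt V W"
    unfolding regular_space_def by meson
  show thesis
  proof
    show "closedin (prod_topology T T) (topspace (prod_topology T T) - V)"
      using VW(1) by blast
    show "eventually (\<lambda>p. p \<in> topspace (prod_topology T T) - V) (diagonal_nhds T)"
      unfolding eventually_diagonal_nhds using VW openin_subset[OF VW(2)]
      by (intro exI[of _ W]) (auto simp: disjnt_iff)
    show "(x, y) \<notin> topspace (prod_topology T T) - V"
      using VW(3) by simp
  qed
qed

text \<open>The points may lie outside \<open>G\<close>, where the base of cofinite entourages says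
  nothing directly. A base element \<open>R\<close> inside the trace of a closed \<open>E\<close>
  avoiding \<open>(x, y)\<close> has its closure still inside \<open>E\<close>.\<close>

lemma cofinite_entourage_separates:
  assumes H: "topological_digraph H T" and T: "compact_space T" "Hausdorff_space T"
    and G: "sub_digraph G H" and A: "T closure_of elems G = elems H"
    and cof: "cofinite_digraph G (inf (diagonal_nhds T) (principal (elems G \<times> elems G)))"
    and xy: "x \<in> topspace T" "y \<in> topspace T" "x \<noteq> y"
  obtains S where "cofinite_entourage H (diagonal_nhds T) S" "(x, y) \<notin> S"
proof -
  let ?U = "inf (diagonal_nhds T) (principal (elems G \<times> elems G))"
  obtain E where E: "closedin (prod_topology T T) E" "eventually (\<lambda>p. p \<in> E) (diagonal_nhds T)"
    "(x, y) \<notin> E"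
    using closedin_diagonal_nhd_avoiding[OF T xy] .
  have "entourage (elems G) ?U (E \<inter> elems G \<times> elems G)"
    using E(2) by (auto simp: entourage_def eventually_inf_principal elim: eventually_mono)
  then obtain R where R: "cofinite_entourage G ?U R" "R \<subseteq> E"
    using cof unfolding cofinite_digraph_def by blast
  have "prod_topology T T closure_of R \<subseteq> E"
    using closure_of_minimal[OF R(2) E(1)] .
  then show thesis
    using that[OF cofinite_entourage_closure_of[OF H G A R(1)]] E(3) by blast
qed

section \<open>Limits of finite quotients\<close>

text \<open>Classes are numbered because the finite graphs in \<open>profinite_digraph\<close> have
  natural numbers as elements; \<open>to_nat_on\<close> is injective on a finite quotient.\<close>

definition class_code :: "'a set \<Rightarrow> ('a \<times> 'a) set \<Rightarrow> 'a \<Rightarrow> nat" where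
  "class_code X S x = to_nat_on (X // S) (S `` {x})"

text \<open>Source and target of a code are computed on a representative picked by
  \<open>inv_into\<close>. For a compatible relation of finite index the choice does not
  matter.\<close>

definition quotient_digraph :: "'a digraph \<Rightarrow> ('a \<times> 'a) set \<Rightarrow> nat digraph" where
  "quotient_digraph H S =
     \<lparr>elems = class_code (elems H) S ` elems H,
      verts = class_code (elems H) S ` verts H,
      src = (\<lambda>n. class_code (elems H) S (src H (inv_into (elems H) (class_code (elems H) S) n))),
      tgt = (\<lambda>n. class_code (elems H) S (tgt H (inv_into (elems H) (class_code (elems H) S) n)))\<rparr>"

definition quotient_transition ::
  "'a digraph \<Rightarrow> ('a \<times> 'a) set \<Rightarrow> ('a \<times> 'a) set \<Rightarrow> nat \<Rightarrow> nat" where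
  "quotient_transition H R S n =
     class_code (elems H) R (inv_into (elems H) (class_code (elems H) S) n)"

lemma class_code_eq_iff:
  assumes "equiv X S" "finite (X // S)" "x \<in> X" "y \<in> X"
  shows "class_code X S x = class_code X S y \<longleftrightarrow> (x, y) \<in> S"
proof -
  have "class_code X S x = class_code X S y \<longleftrightarrow> S `` {x} = S `` {y}"
    unfolding class_code_def using assms(2-4) inj_on_to_nat_on[OF countable_finite[OF assms(2)]]
    by (intro inj_on_eq_iff) (auto intro: quotientI)
  also have "\<dots> \<longleftrightarrow> (x, y) \<in> S"
    using assms eq_equiv_class_iff by fastforce
  finally show ?thesis .
qed

lemma finite_class_code_image:
  assumes "finite (X // S)"
  shows "finite (class_code X S ` X)"
proof -
  have "class_code X S ` X \<subseteq> to_nat_on (X // S) ` (X // S)"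
    by (auto simp: class_code_def intro: quotientI)
  then show ?thesis
    using assms finite_subset by blast
qed

lemma class_code_inv_into:
  assumes "equiv X S" "finite (X // S)" "x \<in> X"
  shows "inv_into X (class_code X S) (class_code X S x) \<in> X"
    and "(inv_into X (class_code X S) (class_code X S x), x) \<in> S"
proof -
  show "inv_into X (class_code X S) (class_code X S x) \<in> X"
    using assms(3) by (intro inv_into_into) auto
  then show "(inv_into X (class_code X S) (class_code X S x), x) \<in> S"
    using assms class_code_eq_iff f_inv_into_f by (metis imageI)
qed

lemma quotient_digraph_class_code:
  assumes "digraph H" "compatible_equiv H S" "finite (elems H // S)" "x \<in> elems H"
  shows "src (quotient_digraph H S) (class_code (elems H) S x) = class_code (elems H) S (src H x)"
    and "tgt (quotient_digraph H S) (class_code (elems H) S x) = class_code (elems H) S (tgt H x)"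
proof -
  have S: "equiv (elems H) S"
    using assms(2) by (simp add: compatible_equiv_def)
  let ?y = "inv_into (elems H) (class_code (elems H) S) (class_code (elems H) S x)"
  have y: "?y \<in> elems H" "(?y, x) \<in> S"
    using class_code_inv_into[OF S assms(3,4)] .
  then have "(src H ?y, src H x) \<in> S" "(tgt H ?y, tgt H x) \<in> S"
    using assms(2) by (auto simp: compatible_equiv_def)
  then show "src (quotient_digraph H S) (class_code (elems H) S x) = class_code (elems H) S (src H x)"
    and "tgt (quotient_digraph H S) (class_code (elems H) S x) = class_code (elems H) S (tgt H x)"
    using class_code_eq_iff[OF S assms(3)] digraph_verts_mem[OF assms(1)] y(1) assms(4)
    by (auto simp: quotient_digraph_def)
qed

lemma digraph_quotient_digraph:
  assumes "digraph H" "compatible_equiv H S" "finite (elems H // S)"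
  shows "digraph (quotient_digraph H S)"
  unfolding digraph_def
proof (intro conjI ballI)
  have H: "verts H \<subseteq> elems H" "\<And>x. x \<in> elems H \<Longrightarrow> src H x \<in> verts H \<and> tgt H x \<in> verts H"
    "\<And>x. x \<in> verts H \<Longrightarrow> src H x = x \<and> tgt H x = x"
    using assms(1) by (auto simp: digraph_def)
  show "verts (quotient_digraph H S) \<subseteq> elems (quotient_digraph H S)"
    using H(1) by (auto simp: quotient_digraph_def)
  {
    fix n assume "n \<in> elems (quotient_digraph H S)"
    then obtain x where "x \<in> elems H" "n = class_code (elems H) S x"
      by (auto simp: quotient_digraph_def)
    then have "src (quotient_digraph H S) n \<in> class_code (elems H) S ` verts H \<and>
        tgt (quotient_digraph H S) n \<in> class_code (elems H) S ` verts H"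
      using H(2) quotient_digraph_class_code[OF assms] by simp
    then show "src (quotient_digraph H S) n \<in> verts (quotient_digraph H S)"
      and "tgt (quotient_digraph H S) n \<in> verts (quotient_digraph H S)"
      by (simp_all add: quotient_digraph_def)
  next
    fix n assume "n \<in> verts (quotient_digraph H S)"
    then obtain x where x: "x \<in> verts H" "n = class_code (elems H) S x"
      by (auto simp: quotient_digraph_def)
    then have "x \<in> elems H"
      using H(1) by auto
    then show "src (quotient_digraph H S) n = n" "tgt (quotient_digraph H S) n = n"
      using H(3)[OF x(1)] x(2) quotient_digraph_class_code[OF assms] by simp_all
  }
qed

lemma topological_digraph_discrete:
  assumes "digraph D"
  shows "topological_digraph D (discrete_topology (elems D))"
  using assms by (auto simp: topological_digraph_def digraph_def Pi_iff continuous_map_in_subtopology)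

lemma quotient_transition_class_code:
  assumes "equiv (elems H) R" "finite (elems H // R)" "equiv (elems H) S" "finite (elems H // S)"
    "S \<subseteq> R" "x \<in> elems H"
  shows "quotient_transition H R S (class_code (elems H) S x) = class_code (elems H) R x"
  using class_code_inv_into[OF assms(3,4,6)] assms(5,6)
  unfolding quotient_transition_def by (subst class_code_eq_iff[OF assms(1,2)]) auto

text \<open>The code is constant on classes and these are open, so every preimage is a union of open
  classes.\<close>

lemma continuous_map_class_code:
  assumes "openin (prod_topology T T) S" "equiv (topspace T) S"
  shows "continuous_map T (discrete_topology (class_code (topspace T) S ` topspace T))
    (class_code (topspace T) S)"
  unfolding continuous_map_def
proof (intro conjI allI impI)
  fix V
  let ?P = "{x \<in> topspace T. class_code (topspace T) S x \<in> V}"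
  show "openin T ?P"
  proof (subst openin_subopen, intro ballI exI conjI)
    fix x assume x: "x \<in> ?P"
    then show "openin T (S `` {x})" "x \<in> S `` {x}"
      using openin_equiv_class[OF assms] equiv_class_self[OF assms(2)] by auto
    show "S `` {x} \<subseteq> ?P"
    proof
      fix y assume y: "y \<in> S `` {x}"
      then have "S `` {x} = S `` {y}" "y \<in> topspace T"
        using equiv_class_eq[OF assms(2), of x y] assms(2) by (auto simp: equiv_def)
      then show "y \<in> ?P"
        using x by (simp add: class_code_def)
    qed
  qed
qed auto

text \<open>Finer relations are larger in the order, so the transition map goes from the finer
  quotient to the coarser one and \<open>R \<inter> S\<close> is an upper bound of \<open>R\<close>
  and \<open>S\<close>.\<close>

lemma inverse_system_quotient_digraph:
  assumes H: "digraph H" and I: "I \<noteq> {}"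
    and fin: "\<And>S. S \<in> I \<Longrightarrow> compatible_equiv H S \<and> finite (elems H // S)"
    and Int: "\<And>R S. R \<in> I \<Longrightarrow> S \<in> I \<Longrightarrow> R \<inter> S \<in> I"
  shows "inverse_system I {(R, S). R \<in> I \<and> S \<in> I \<and> S \<subseteq> R} (quotient_digraph H)
    (\<lambda>S. discrete_topology (elems (quotient_digraph H S))) (quotient_transition H)"
proof -
  have I': "compatible_equiv H S" "equiv (elems H) S" "finite (elems H // S)" if "S \<in> I" for S
    using fin[OF that] by (auto simp: compatible_equiv_def)
  have elems: "elems (quotient_digraph H S) = class_code (elems H) S ` elems H" for S
    by (simp add: quotient_digraph_def)
  have tr: "quotient_transition H R S (class_code (elems H) S x) = class_code (elems H) R x"
    if "R \<in> I" "S \<in> I" "S \<subseteq> R" "x \<in> elems H" for R S x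
    using quotient_transition_class_code[OF I'(2,3)[OF that(1)] I'(2,3)[OF that(2)] that(3,4)] .
  have map: "digraph_map (quotient_digraph H S) (quotient_digraph H R) (quotient_transition H R S)"
    if "R \<in> I" "S \<in> I" "S \<subseteq> R" for R S
  proof -
    note qR = quotient_digraph_class_code[OF H I'(1)[OF that(1)] I'(3)[OF that(1)]]
    note qS = quotient_digraph_class_code[OF H I'(1)[OF that(2)] I'(3)[OF that(2)]]
    have "quotient_transition H R S n \<in> class_code (elems H) R ` elems H \<and>
        quotient_transition H R S (src (quotient_digraph H S) n) =
          src (quotient_digraph H R) (quotient_transition H R S n) \<and>
        quotient_transition H R S (tgt (quotient_digraph H S) n) =
          tgt (quotient_digraph H R) (quotient_transition H R S n)"
      if "n \<in> class_code (elems H) S ` elems H" for n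
    proof -
      \<comment> \<open>Written as the code of an actual element, \<open>n\<close> is moved by the
        transition map without reference to the chosen representative.\<close>
      obtain x where x: "x \<in> elems H" "n = class_code (elems H) S x"
        using \<open>n \<in> _\<close> by blast
      then show ?thesis
        using digraph_verts_mem[OF H x(1)] by (simp add: tr[OF \<open>R \<in> I\<close> \<open>S \<in> I\<close> \<open>S \<subseteq> R\<close>] qR qS)
    qed
    then show ?thesis
      by (simp add: digraph_map_def elems)
  qed
  have po: "partial_order_on I {(R, S). R \<in> I \<and> S \<in> I \<and> S \<subseteq> R}"
    by (auto simp: partial_order_on_def preorder_on_def refl_on_def intro!: transI antisymI)
  have dir: "\<exists>K\<in>I. (R, K) \<in> {(R, S). R \<in> I \<and> S \<in> I \<and> S \<subseteq> R} \<and>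
      (S, K) \<in> {(R, S). R \<in> I \<and> S \<in> I \<and> S \<subseteq> R}" if "R \<in> I" "S \<in> I" for R S
    using that Int[OF that] by (intro bexI[of _ "R \<inter> S"]) auto
  have top: "topological_digraph (quotient_digraph H S)
      (discrete_topology (elems (quotient_digraph H S)))" if "S \<in> I" for S
    using topological_digraph_discrete digraph_quotient_digraph[OF H I'(1,3)] that by blast
  have cont: "continuous_map (discrete_topology (elems (quotient_digraph H S)))
      (discrete_topology (elems (quotient_digraph H R))) (quotient_transition H R S)"
    if "R \<in> I" "S \<in> I" "S \<subseteq> R" for R S
    using map[OF that] by (auto simp: digraph_map_def)
  have id: "quotient_transition H S S n = n"
    if "S \<in> I" "n \<in> elems (quotient_digraph H S)" for S n
    using that tr[of S S] by (auto simp: elems)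
  have comp: "quotient_transition H Q R (quotient_transition H R S n) = quotient_transition H Q S n"
    if "Q \<in> I" "R \<in> I" "S \<in> I" "R \<subseteq> Q" "S \<subseteq> R" "n \<in> elems (quotient_digraph H S)" for Q R S n
    using that tr[of Q R] tr[of R S] tr[of Q S] by (auto simp: elems)
  show ?thesis
    unfolding inverse_system_def using I po
  proof (intro conjI)
    show "\<forall>R\<in>I. \<forall>S\<in>I. \<exists>K\<in>I. (R, K) \<in> {(R, S). R \<in> I \<and> S \<in> I \<and> S \<subseteq> R} \<and>
        (S, K) \<in> {(R, S). R \<in> I \<and> S \<in> I \<and> S \<subseteq> R}"
      using dir by blast
  qed (use top map cont id comp in auto)
qed

section \<open>Compact directed graphs as limits of their finite quotients\<close>

lemma finite_lower_bound:
  assumes "finite J" "J \<subseteq> I" "I \<noteq> {}" and Int: "\<And>R S. R \<in> I \<Longrightarrow> S \<in> I \<Longrightarrow> R \<inter> S \<in> I"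
  obtains S where "S \<in> I" "\<And>R. R \<in> J \<Longrightarrow> S \<subseteq> R"
proof -
  from assms(1,2) have "\<exists>S\<in>I. \<forall>R\<in>J. S \<subseteq> R"
  proof induction
    case empty
    then show ?case using assms(3) by auto
  next
    case (insert R J)
    then obtain S where "S \<in> I" "\<forall>R\<in>J. S \<subseteq> R" by auto
    then show ?case
      using insert.prems Int[of R S] by (intro bexI[of _ "R \<inter> S"]) auto
  qed
  then show thesis using that by blast
qed

text \<open>The map \<open>f\<close> sends a point to the family of its class codes. Separation
  makes it injective, compactness makes it surjective, and a continuous bijection from a compact
  space to a Hausdorff space is a homeomorphism.\<close>

lemma profinite_digraphI:
  fixes H :: "'a digraph" and I :: "('a \<times> 'a) set set"
  assumes H: "topological_digraph H T" and T: "compact_space T"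
    and I: "I \<noteq> {}"
    and fin: "\<And>S. S \<in> I \<Longrightarrow>
      compatible_equiv H S \<and> finite (elems H // S) \<and> openin (prod_topology T T) S"
    and Int: "\<And>R S. R \<in> I \<Longrightarrow> S \<in> I \<Longrightarrow> R \<inter> S \<in> I"
    and sep: "\<And>x y. x \<in> topspace T \<Longrightarrow> y \<in> topspace T \<Longrightarrow> x \<noteq> y \<Longrightarrow> \<exists>S\<in>I. (x, y) \<notin> S"
  shows "profinite_digraph H T"
proof -
  define le where "le = {(R, S). R \<in> I \<and> S \<in> I \<and> S \<subseteq> R}"
  define D where "D = quotient_digraph H"
  define Tp where "Tp = (\<lambda>S. discrete_topology (elems (D S)))"
  define tr where "tr = quotient_transition H"
  define q where "q = class_code (elems H)"
  define f where "f = (\<lambda>x. \<lambda>S\<in>I. q S x)"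
  let ?L = "inverse_limit I le D tr"
  let ?LT = "inverse_limit_topology I le D Tp tr"
  have dH: "digraph H" and X: "topspace T = elems H"
    using H by (auto simp: topological_digraph_def)
  have I': "compatible_equiv H S" "equiv (elems H) S" "finite (elems H // S)"
    "openin (prod_topology T T) S" if "S \<in> I" for S
    using fin[OF that] by (auto simp: compatible_equiv_def)
  have q: "q S x = q S y \<longleftrightarrow> (x, y) \<in> S" if "S \<in> I" "x \<in> elems H" "y \<in> elems H" for S x y
    unfolding q_def using class_code_eq_iff[OF I'(2,3)[OF that(1)] that(2,3)] .
  have tr: "tr R S (q S x) = q R x" if "R \<in> I" "S \<in> I" "S \<subseteq> R" "x \<in> elems H" for R S x
    unfolding q_def tr_def
    using quotient_transition_class_code[OF I'(2,3)[OF that(1)] I'(2,3)[OF that(2)] that(3,4)] .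
  have elems_D: "elems (D S) = q S ` elems H" for S
    by (simp add: D_def q_def quotient_digraph_def)
  have sys: "inverse_system I le D Tp tr"
    unfolding le_def D_def Tp_def tr_def
    using fin by (intro inverse_system_quotient_digraph dH I Int) auto
  have elems_L: "elems ?L = {y \<in> \<Pi>\<^sub>E S\<in>I. elems (D S). \<forall>(R, S)\<in>le. tr R S (y S) = y R}"
    by (simp add: inverse_limit_def)
  have f_in: "f x \<in> elems ?L" if "x \<in> elems H" for x
    unfolding elems_L elems_D f_def using that tr by (auto simp: le_def)
  have map: "digraph_map H ?L f"
    unfolding digraph_map_def
  proof (intro conjI ballI)
    show "f \<in> elems H \<rightarrow> elems ?L"
      using f_in by auto
    fix x assume x: "x \<in> elems H"
    have st: "src (D S) (q S x) = q S (src H x)" "tgt (D S) (q S x) = q S (tgt H x)"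
      if "S \<in> I" for S
      using quotient_digraph_class_code[OF dH I'(1)[OF that] I'(3)[OF that] x]
      by (simp_all add: D_def q_def)
    show "f (src H x) = src ?L (f x)"
      using st by (auto simp: f_def inverse_limit_def restrict_def fun_eq_iff)
    show "f (tgt H x) = tgt ?L (f x)"
      using st by (auto simp: f_def inverse_limit_def restrict_def fun_eq_iff)
  qed
  have topspace_LT: "topspace ?LT = elems ?L"
    by (auto simp: inverse_limit_topology_def Tp_def elems_L)
  have cont: "continuous_map T ?LT f"
    unfolding inverse_limit_topology_def continuous_map_in_subtopology continuous_map_componentwise
  proof (intro conjI ballI)
    show "f ` topspace T \<subseteq> extensional I"
      by (auto simp: f_def)
    show "f \<in> topspace T \<rightarrow> elems ?L"
      using f_in X by auto
    fix S assume S: "S \<in> I"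
    then have "(\<lambda>x. f x S) = q S"
      by (simp add: f_def fun_eq_iff)
    then show "continuous_map T (Tp S) (\<lambda>x. f x S)"
      using continuous_map_class_code[of T S] I'[OF S] X by (simp add: Tp_def elems_D q_def)
  qed
  have "Hausdorff_space ?LT"
    unfolding inverse_limit_topology_def
    by (intro Hausdorff_space_subtopology) (simp add: Hausdorff_space_product_topology Tp_def)
  moreover have "inj_on f (topspace T)"
  proof (rule inj_onI, rule ccontr)
    fix x y assume xy: "x \<in> topspace T" "y \<in> topspace T" "f x = f y" "x \<noteq> y"
    then obtain S where S: "S \<in> I" "(x, y) \<notin> S"
      using sep by blast
    have "f x S = f y S" using xy(3) by simp
    then have "q S x = q S y"
      using S(1) by (simp add: f_def)
    then show False
      using q[OF S(1)] S(2) xy(1,2) X by auto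
  qed
  moreover have "f ` topspace T = topspace ?LT"
  proof
    show "f ` topspace T \<subseteq> topspace ?LT"
      using f_in X topspace_LT by auto
    show "topspace ?LT \<subseteq> f ` topspace T"
    proof
      fix y assume "y \<in> topspace ?LT"
      then have y: "y \<in> (\<Pi>\<^sub>E S\<in>I. elems (D S))" "\<And>R S. (R, S) \<in> le \<Longrightarrow> tr R S (y S) = y R"
        unfolding topspace_LT elems_L by auto
      \<comment> \<open>A point mapped to \<open>y\<close> lies in the fibre of \<open>q S\<close>
        over \<open>y S\<close> for every \<open>S\<close>; these fibres are closed, so the finite
        intersection property will produce one.\<close>
      define K where "K S = {x \<in> topspace T. q S x \<in> {y S}}" for S
      have "closedin T (K S)" if "S \<in> I" for S
      proof -
        have "continuous_map T (Tp S) (q S)"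
          using continuous_map_class_code[of T S] I'[OF that] X by (simp add: Tp_def elems_D q_def)
        moreover have "closedin (Tp S) {y S}"
          using y(1) that by (auto simp: Tp_def)
        ultimately show ?thesis
          unfolding K_def by (rule closedin_continuous_map_preimage)
      qed
      moreover have "\<Inter>\<F> \<noteq> {}" if "finite \<F>" "\<F> \<subseteq> K ` I" for \<F>
      proof -
        obtain J where J: "finite J" "J \<subseteq> I" "\<F> = K ` J"
          using finite_subset_image[OF \<open>finite \<F>\<close> \<open>\<F> \<subseteq> K ` I\<close>] by blast
        \<comment> \<open>A single \<open>S\<close> finer than all of \<open>J\<close> meets all
          constraints at once: any \<open>x\<close> with code \<open>y S\<close> has code
          \<open>tr R S (y S) = y R\<close> for each \<open>R\<close> in \<open>J\<close>.\<close>
        obtain S where S: "S \<in> I" "\<And>R. R \<in> J \<Longrightarrow> S \<subseteq> R"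
          using finite_lower_bound[OF J(1,2) I Int] by blast
        have "y S \<in> q S ` elems H"
          using y(1) S(1) elems_D by auto
        then obtain x where x: "x \<in> elems H" "y S = q S x"
          by auto
        have "x \<in> K R" if R: "R \<in> J" for R
        proof -
          have "R \<in> I" "S \<subseteq> R"
            using R J(2) S(2) by auto
          then have "q R x = y R"
            using tr[of R S x] y(2)[of R S] S(1) x by (simp add: le_def)
          then show ?thesis
            using x(1) X by (simp add: K_def)
        qed
        then show ?thesis
          using J(3) by blast
      qed
      ultimately have "\<Inter>(K ` I) \<noteq> {}"
        using T[unfolded compact_space_fip, rule_format, of "K ` I"] by blast
      then obtain x where x: "\<And>S. S \<in> I \<Longrightarrow> x \<in> K S"
        by blast
      \<comment> \<open>With an empty \<open>I\<close> the intersection would be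
        \<open>UNIV\<close>; some \<open>K S\<close> is needed to place \<open>x\<close> in the
        space.\<close>
      then have "x \<in> topspace T"
        using I by (auto simp: K_def)
      \<comment> \<open>Equality of functions also concerns arguments outside \<open>I\<close>,
        where both sides are \<open>undefined\<close>.\<close>
      moreover have "f x = y"
        using x y(1) by (auto simp: f_def K_def fun_eq_iff restrict_def PiE_def extensional_def)
      ultimately show "y \<in> f ` topspace T"
        by blast
    qed
  qed
  ultimately have "homeomorphic_map T ?LT f"
    using T cont by (intro continuous_imp_homeomorphic_map)
  moreover have "\<forall>S\<in>I. finite (elems (D S)) \<and> Tp S = discrete_topology (elems (D S))"
    using finite_class_code_image I'(3) by (auto simp: elems_D q_def Tp_def)
  ultimately show ?thesis
    unfolding profinite_digraph_def topological_digraph_iso_def using H sys map by blast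
qed

text \<open>Provides an element of the index set. The quotient is only bounded by
  \<open>{elems H}\<close>, since it is empty for the empty graph.\<close>

lemma cofinite_entourage_Times:
  assumes "digraph H" "topspace T = elems H"
  shows "cofinite_entourage H (diagonal_nhds T) (elems H \<times> elems H)"
proof -
  have eq: "equiv (elems H) (elems H \<times> elems H)"
    by (intro equivI) (auto simp: refl_on_def intro!: symI transI)
  moreover have "finite (elems H // (elems H \<times> elems H))"
    by (rule finite_subset[of _ "{elems H}"]) (auto simp: quotient_def)
  moreover have "entourage (elems H) (diagonal_nhds T) (elems H \<times> elems H)"
    using equiv_entourage_iff_openin[of T "elems H \<times> elems H"] eq assms(2)
      openin_topspace[of "prod_topology T T"] by (simp del: openin_topspace)
  ultimately show ?thesis
    using digraph_verts_mem[OF assms(1)] by (auto simp: cofinite_entourage_def compatible_equiv_def)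
qed

lemma cofinite_entourageD:
  assumes "cofinite_entourage H (diagonal_nhds T) S" "topspace T = elems H"
  shows "compatible_equiv H S" "finite (elems H // S)" "equiv (topspace T) S"
    "openin (prod_topology T T) S"
proof -
  show "compatible_equiv H S" "finite (elems H // S)"
    using assms(1) by (simp_all add: cofinite_entourage_def)
  show S: "equiv (topspace T) S"
    using assms by (simp add: cofinite_entourage_def compatible_equiv_def)
  have "entourage (topspace T) (diagonal_nhds T) S"
    using assms by (simp add: cofinite_entourage_def)
  then show "openin (prod_topology T T) S"
    by (simp only: equiv_entourage_iff_openin[OF S])
qed

theorem theorem5p10:
  fixes G H :: "'a digraph" and U :: "('a \<times> 'a) filter" and T :: "'a topology"
  assumes "cofinite_digraph G U"
    and "digraph_completion G U H T"
  shows "profinite_digraph H T \<and>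
    {S. cofinite_entourage H (compact_uniformity T) S} =
    {prod_topology T T closure_of R | R. cofinite_entourage G U R}"
proof -
  have H: "topological_digraph H T" and T: "compact_space T" "Hausdorff_space T"
    and G: "sub_digraph G H" and A: "T closure_of elems G = elems H"
    and U': "U = inf (compact_uniformity T) (principal (elems G \<times> elems G))"
    using assms(2) by (auto simp: digraph_completion_def)
  have N: "compact_uniformity T = diagonal_nhds T"
    using compact_uniformity_eq_diagonal_nhds[OF T] .
  have U: "U = inf (diagonal_nhds T) (principal (elems G \<times> elems G))"
    using U' N by simp
  have dH: "digraph H" and X: "topspace T = elems H"
    using H by (auto simp: topological_digraph_def)
  \<comment> \<open>Taking all cofinite entourages as indices gives closure under intersection,
    hence directedness, without any choice.\<close>
  let ?I = "{S. cofinite_entourage H (diagonal_nhds T) S}"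
  have "profinite_digraph H T"
  proof (rule profinite_digraphI[OF H T(1), of ?I])
    show "?I \<noteq> {}"
      using cofinite_entourage_Times[OF dH X] by blast
    show "\<exists>S\<in>?I. (x, y) \<notin> S" if "x \<in> topspace T" "y \<in> topspace T" "x \<noteq> y" for x y
      using cofinite_entourage_separates[OF H T G A assms(1)[unfolded U] that] by blast
  qed (use cofinite_entourageD[OF _ X] cofinite_entourage_Int in auto)
  moreover have "?I = {prod_topology T T closure_of R | R. cofinite_entourage G U R}"
  proof (intro set_eqI iffI)
    fix S assume "S \<in> ?I"
    then have S: "cofinite_entourage H (diagonal_nhds T) S"
      by simp
    \<comment> \<open>The required \<open>R\<close> is the trace of \<open>S\<close>, which is a
      cofinite entourage for the induced uniformity.\<close>
    have "S = prod_topology T T closure_of (S \<inter> elems G \<times> elems G)"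
      using closure_of_restrict_open_equiv[of T S "elems G"] cofinite_entourageD[OF S X] A X by simp
    then show "S \<in> {prod_topology T T closure_of R | R. cofinite_entourage G U R}"
      using cofinite_entourage_restrict[OF G S] U by blast
  next
    fix S assume "S \<in> {prod_topology T T closure_of R | R. cofinite_entourage G U R}"
    then show "S \<in> ?I"
      using cofinite_entourage_closure_of[OF H G A] U by auto
  qed
  ultimately show ?thesis
    by (simp add: N)
qed

end
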